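(* Let $H$ be a star. The class of $F$-free graphs has bounded $H$-avoiding chromatic number if and only if $F$ is a star.
   Context: All graphs are simple and have no loops. A star is a complete bipartite graph $K_{1,d}$. A graph $G$ is $F$-free if it does not contain $F$ as a (not necessarily induced) subgraph. A proper $k$-coloring of $G$ is a map from $V(G)$ to a set of $k$ colors such that adjacent vertices receive different colors. Given a graph $G$ and a (smaller) connected graph $H$, an $H$-avoiding $k$-coloring of $G$ is a proper $k$-coloring of $G$ with the additional constraint that there is no bicolored $H$, i.e. no (not necessarily induced) subgraph of $G$ isomorphic to $H$ whose vertices receive at most two colors. A class $\mathcal{C}$ of graphs has bounded $H$-avoiding chromatic number if there is a function $f(H)$ (not depending on the individual graph in $\mathcal{C}$) such that each graph in $\mathcal{C}$ has an $H$-avoiding $f(H)$-coloring.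
   Formalization: The formal theorem assumes that H has at least three vertices (not K_1 or K_2), that F is nonempty, and that F is not a star together with one or more isolated vertices; the stated equivalence fails in these degenerate cases. *)

theory Defs
  imports "Graph_Theory.Graph_Theory"
begin

(* Finite simple graphs are those G :: 'a pair_pre_digraph with pair_graph G: the vertex set is
   finite and each undirected edge {u, v} is represented by the two arcs (u, v) and (v, u). *)

(* K_{1,0}, a single vertex, counts as a star. *)
definition is_star :: "'a pair_pre_digraph \<Rightarrow> bool" where
  "is_star G \<longleftrightarrow> (\<exists>d. complete_bipartite_digraph 1 d (with_proj G))"

(* S is a subgraph of G, not necessarily induced, that is isomorphic to H. *)
definition copy_of_in ::
    "'a pair_pre_digraph \<Rightarrow> 'b pair_pre_digraph \<Rightarrow> 'b pair_pre_digraph \<Rightarrow> bool" where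
  "copy_of_in H S G \<longleftrightarrow>
     pair_graph S \<and> subgraph (with_proj S) (with_proj G) \<and> digraph_iso (with_proj S) (with_proj H)"

(* Every finite graph is isomorphic to one with vertices in nat, so taking nat as the vertex type
   loses no graphs. *)
definition free_class :: "'a pair_pre_digraph \<Rightarrow> nat pair_pre_digraph set" where
  "free_class F = {G. pair_graph G \<and> (\<nexists>S. copy_of_in F S G)}"

definition proper_coloring :: "'a pair_pre_digraph \<Rightarrow> nat \<Rightarrow> ('a \<Rightarrow> nat) \<Rightarrow> bool" where
  "proper_coloring G k c \<longleftrightarrow>
     c ` pverts G \<subseteq> {..<k} \<and> (\<forall>u v. (u, v) \<in> parcs G \<longrightarrow> c u \<noteq> c v)"

definition avoiding_coloring ::
    "'a pair_pre_digraph \<Rightarrow> 'b pair_pre_digraph \<Rightarrow> nat \<Rightarrow> ('b \<Rightarrow> nat) \<Rightarrow> bool" where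
  "avoiding_coloring H G k c \<longleftrightarrow>
     proper_coloring G k c \<and> (\<nexists>S. copy_of_in H S G \<and> card (c ` pverts S) \<le> 2)"

(* For a fixed H, the bound f(H) is a single number k serving all graphs of the class. *)
definition bounded_avoiding_chromatic_number ::
    "'a pair_pre_digraph \<Rightarrow> 'b pair_pre_digraph set \<Rightarrow> bool" where
  "bounded_avoiding_chromatic_number H \<C> \<longleftrightarrow>
     (\<exists>k. \<forall>G\<in>\<C>. \<exists>c. avoiding_coloring H G k c)"

(* F consists of a star together with at least one additional isolated vertex. *)
definition star_with_isolated_vertices :: "'a pair_pre_digraph \<Rightarrow> bool" where
  "star_with_isolated_vertices F \<longleftrightarrow>
     (\<exists>S. S \<subset> pverts F \<and> is_star \<lparr>pverts = S, parcs = parcs F\<rparr>)"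

end

theory Submission
  imports Defs
begin

text \<open>
  Let \<open>H\<close> be a star with at least two leaves.

  If \<open>F\<close> is a star with \<open>m\<close> leaves, then being \<open>F\<close>-free means that every degree is less than
  \<open>m\<close> (\<open>star_free_degree\<close>), so every vertex has at most \<open>m + m * m\<close> others within distance two.
  Hence \<open>m + m * m + 1\<close> colors suffice to color greedily so that any two vertices at distance one
  or two receive different colors (\<open>greedy_coloring\<close>, \<open>distance_two_coloring\<close>). In such a coloring
  the center and two leaves of any copy of \<open>H\<close> already use three colors.

  If \<open>F\<close> is not a star, the obstruction is the class of all stars. A nonempty subgraph of a star
  is a star together with possibly some isolated vertices (\<open>nonempty_subgraph_of_star\<close>). The
  nonempty graph \<open>F\<close> is neither a star nor a star with isolated vertices, so it is contained in no
  star, and all stars are \<open>F\<close>-free (\<open>star_is_free\<close>). But with a fixed number of colors, a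
  sufficiently large star has many leaves of one color (\<open>large_color_class\<close>), and they form a
  bicolored copy of \<open>H\<close> with the center (\<open>large_star_has_no_avoiding_coloring\<close>).
\<close>

section \<open>Stars and their copies\<close>

definition star :: "'a \<Rightarrow> 'a set \<Rightarrow> 'a pair_pre_digraph" where
  "star x L = \<lparr>pverts = insert x L, parcs = {x} \<times> L \<union> L \<times> {x}\<rparr>"

lemma star_simps [simp]:
  "pverts (star x L) = insert x L"
  "parcs (star x L) = {x} \<times> L \<union> L \<times> {x}"
  by (simp_all add: star_def)

lemma pair_graph_star:
  assumes "finite L" "x \<notin> L"
  shows "pair_graph (star x L)"
  using assms by unfold_locales (auto simp: symmetric_def intro!: symI)

lemma is_star_iff: "is_star G \<longleftrightarrow> (\<exists>x L. finite L \<and> x \<notin> L \<and> G = star x L)"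
proof
  assume "is_star G"
  then obtain U V where *: "finite (pverts G)" "pverts G = U \<union> V" "U \<inter> V = {}" "card U = 1"
      "parcs G = U \<times> V \<union> V \<times> U"
    unfolding is_star_def complete_bipartite_digraph_pair_def by blast
  then obtain x where "U = {x}" by (auto simp: card_1_singleton_iff)
  with * show "\<exists>x L. finite L \<and> x \<notin> L \<and> G = star x L"
    by (intro exI[of _ x] exI[of _ V]) (auto simp: star_def)
next
  assume "\<exists>x L. finite L \<and> x \<notin> L \<and> G = star x L"
  then obtain x L where *: "finite L" "x \<notin> L" "G = star x L" by blast
  show "is_star G"
    unfolding is_star_def complete_bipartite_digraph_pair_def
    by (rule exI[of _ "card L"], intro conjI exI[of _ "{x}"] exI[of _ L]) (use * in auto)
qed

text \<open>
  For graphs whose arcs are pairs of vertices, an isomorphism is determined by its action on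
  vertices; the arc map of the general notion carries no further information.
\<close>
lemma digraph_iso_pair_iff:
  assumes "pair_graph S"
  shows "digraph_iso (with_proj S) (with_proj F) \<longleftrightarrow>
    (\<exists>f. inj_on f (pverts S) \<and> pverts F = f ` pverts S \<and> parcs F = map_prod f f ` parcs S)"
proof
  interpret S: pair_graph S by fact
  assume "digraph_iso (with_proj S) (with_proj F)"
  then obtain h where h: "S.digraph_isomorphism h" "with_proj F = app_iso h (with_proj S)"
    unfolding digraph_iso_def by blast
  have "parcs F = arcs_ends (app_iso h (with_proj S))"
    by (simp flip: h(2))
  then have arcs: "parcs F = map_prod (iso_verts h) (iso_verts h) ` parcs S"
    using S.arcs_ends_app_iso_eq[OF h(1)] by (simp add: map_prod_def)
  have "pverts F = verts (app_iso h (with_proj S))"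
    by (simp flip: h(2))
  then have "pverts F = iso_verts h ` pverts S"
    by simp
  then show "\<exists>f. inj_on f (pverts S) \<and> pverts F = f ` pverts S \<and> parcs F = map_prod f f ` parcs S"
    using arcs S.digraph_isomorphism_inj_on_verts[OF h(1)] by blast
next
  interpret S: pair_graph S by fact
  assume "\<exists>f. inj_on f (pverts S) \<and> pverts F = f ` pverts S \<and> parcs F = map_prod f f ` parcs S"
  then obtain f where f: "inj_on f (pverts S)" "pverts F = f ` pverts S"
      "parcs F = map_prod f f ` parcs S" by blast
  let ?h = "\<lparr>iso_verts = f, iso_arcs = map_prod f f, iso_head = snd, iso_tail = fst\<rparr>"
  have "inj_on (map_prod f f) (pverts S \<times> pverts S)"
    using f(1) by (simp add: map_prod_inj_on)
  then have "inj_on (map_prod f f) (parcs S)"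
    by (rule inj_on_subset) (auto dest: S.wellformed')
  then have "S.digraph_isomorphism ?h"
    using f(1) by (auto simp: S.digraph_isomorphism_def S.wf_digraph_axioms)
  moreover have "with_proj F = app_iso ?h (with_proj S)"
    using f(2,3) by (simp add: with_proj_def app_iso_def)
  ultimately show "digraph_iso (with_proj S) (with_proj F)"
    unfolding digraph_iso_def by blast
qed

lemma map_prod_star_arcs:
  "map_prod f f ` ({x} \<times> L \<union> L \<times> {x}) = {f x} \<times> f ` L \<union> f ` L \<times> {f x}"
  by force

definition neighbors :: "'a pair_pre_digraph \<Rightarrow> 'a \<Rightarrow> 'a set" where
  "neighbors G x = {v. (x, v) \<in> parcs G}"

lemma copy_of_starI:
  assumes G: "pair_graph G" and x: "x \<in> pverts G" and L: "L \<subseteq> neighbors G x"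
    and M: "finite M" "y \<notin> M" and card: "card L = card M"
  shows "copy_of_in (star y M) (star x L) G"
proof -
  interpret G: pair_graph G by fact
  have xL: "x \<notin> L"
    using L G.no_loops' by (auto simp: neighbors_def)
  have LV: "L \<subseteq> pverts G"
    using L by (auto simp: neighbors_def dest: G.wellformed')
  then have fin: "finite L"
    using G.pair_finite_verts finite_subset by blast
  interpret S: pair_graph "star x L"
    using pair_graph_star[OF fin xL] .
  obtain g where g: "bij_betw g L M"
    using fin M(1) card finite_same_card_bij by blast
  let ?f = "g(x := y)"
  have im: "?f ` L = M" and inj: "inj_on ?f L"
    using g xL by (auto simp: bij_betw_def inj_on_def)
  have "parcs (star y M) = map_prod ?f ?f ` parcs (star x L)"
    using im unfolding star_simps map_prod_star_arcs by simp
  moreover have "inj_on ?f (pverts (star x L))"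
    using inj im M(2) xL by (auto simp: inj_on_def)
  moreover have "pverts (star y M) = ?f ` pverts (star x L)"
    using im by auto
  ultimately have "digraph_iso (with_proj (star x L)) (with_proj (star y M))"
    unfolding digraph_iso_pair_iff[OF S.pair_graph] by blast
  moreover have "subgraph (with_proj (star x L)) (with_proj G)"
    using x LV L G.arcs_symmetric
    by (auto simp: subgraph_def compatible_def neighbors_def S.wf_digraph_axioms G.wf_digraph_axioms)
  ultimately show ?thesis
    by (simp add: copy_of_in_def S.pair_graph)
qed

lemma copy_of_starE:
  assumes "copy_of_in (star y M) S G" and M: "finite M" "y \<notin> M"
  obtains x L where "S = star x L" "L \<subseteq> neighbors G x" "card L = card M"
proof -
  from assms(1) have S: "pair_graph S" and sub: "subgraph (with_proj S) (with_proj G)"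
    and iso: "digraph_iso (with_proj S) (with_proj (star y M))"
    by (auto simp: copy_of_in_def)
  interpret S: pair_graph S by fact
  obtain f where f: "inj_on f (pverts S)" "insert y M = f ` pverts S"
      "{y} \<times> M \<union> M \<times> {y} = map_prod f f ` parcs S"
    using iso unfolding digraph_iso_pair_iff[OF S] by auto
  define x where "x = the_inv_into (pverts S) f y"
  have x: "x \<in> pverts S" "f x = y"
    unfolding x_def using f by (auto intro!: the_inv_into_into f_the_inv_into_f)
  define L where "L = pverts S - {x}"
  have xL: "x \<notin> L" and verts: "pverts S = insert x L"
    using x by (auto simp: L_def)
  have im: "f ` L = M"
  proof -
    have "y \<notin> f ` L"
      using f(1) x(2) xL unfolding verts by (auto simp: inj_on_def)
    moreover have "insert y (f ` L) = insert y M"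
      using f(2) x(2) unfolding verts by simp
    ultimately show ?thesis
      using M(2) by (metis Diff_insert_absorb)
  qed
  have inj: "inj_on f L"
    using f(1) unfolding verts by (auto simp: inj_on_def)
  have "map_prod f f ` parcs S = map_prod f f ` ({x} \<times> L \<union> L \<times> {x})"
    unfolding f(3)[symmetric] map_prod_star_arcs im x(2) ..
  moreover have "inj_on (map_prod f f) (pverts S \<times> pverts S)"
    using f(1) by (simp add: map_prod_inj_on)
  moreover have "parcs S \<subseteq> pverts S \<times> pverts S" "{x} \<times> L \<union> L \<times> {x} \<subseteq> pverts S \<times> pverts S"
    using verts by (auto dest: S.wellformed')
  ultimately have arcs: "parcs S = {x} \<times> L \<union> L \<times> {x}"
    by (simp only: inj_on_image_eq_iff)
  have "S = star x L"
    using verts arcs by (simp add: star_def)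
  moreover have "L \<subseteq> neighbors G x"
    using sub arcs by (auto simp: subgraph_def neighbors_def)
  moreover have "card L = card M"
    using card_image[OF inj] im by simp
  ultimately show thesis by (rule that)
qed

section \<open>Colorings of star-free graphs\<close>

lemma star_free_degree:
  assumes "G \<in> free_class (star y M)" "finite M" "y \<notin> M" "x \<in> pverts G"
  shows "card (neighbors G x) < card M"
proof (rule ccontr)
  assume "\<not> card (neighbors G x) < card M"
  then obtain L where L: "L \<subseteq> neighbors G x" "card L = card M"
    by (metis leI obtain_subset_with_card_n)
  have "copy_of_in (star y M) (star x L) G"
    using assms L by (intro copy_of_starI) (auto simp: free_class_def)
  with assms(1) show False
    by (auto simp: free_class_def)
qed

text \<open>
  Each vertex in turn receives a color that none of its at most \<open>n\<close> colored \<open>R\<close>-neighbors has.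
\<close>
lemma greedy_coloring:
  assumes "finite V" and "symp R"
    and "\<And>v. v \<in> V \<Longrightarrow> card {w \<in> V. w \<noteq> v \<and> R v w} \<le> n"
  shows "\<exists>c :: 'a \<Rightarrow> nat. c ` V \<subseteq> {..n} \<and> (\<forall>v\<in>V. \<forall>w\<in>V. w \<noteq> v \<and> R v w \<longrightarrow> c v \<noteq> c w)"
  using assms(1,3)
proof (induction V)
  case empty
  then show ?case by simp
next
  case (insert a V)
  have "card {w \<in> V. w \<noteq> v \<and> R v w} \<le> n" if "v \<in> V" for v
  proof -
    have "card {w \<in> V. w \<noteq> v \<and> R v w} \<le> card {w \<in> insert a V. w \<noteq> v \<and> R v w}"
      using insert.hyps(1) by (intro card_mono) auto
    also have "\<dots> \<le> n"
      using insert.prems that by simp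
    finally show ?thesis .
  qed
  from insert.IH[OF this] obtain c :: "'a \<Rightarrow> nat" where c: "c ` V \<subseteq> {..n}"
      "\<forall>v\<in>V. \<forall>w\<in>V. w \<noteq> v \<and> R v w \<longrightarrow> c v \<noteq> c w"
    by blast
  define B where "B = {w \<in> insert a V. w \<noteq> a \<and> R a w}"
  have "finite B"
    using insert.hyps(1) by (simp add: B_def)
  then have "card (c ` B) \<le> card B"
    by (rule card_image_le)
  also have "card B \<le> n"
    using insert.prems by (simp add: B_def)
  also have "n < card {..n}"
    by simp
  finally obtain i where i: "i \<le> n" "i \<notin> c ` B"
    by (metis \<open>finite B\<close> atMost_iff card_mono finite_imageI leD subsetI)
  have "R a v" if "R v a" for v
    using that \<open>symp R\<close> by (auto dest: sympD)
  then have "\<forall>v\<in>insert a V. \<forall>w\<in>insert a V. w \<noteq> v \<and> R v w \<longrightarrow> (c(a := i)) v \<noteq> (c(a := i)) w"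
    using c(2) i(2) by (auto simp: B_def)
  moreover have "(c(a := i)) ` insert a V \<subseteq> {..n}"
    using c(1) i(1) by auto
  ultimately show ?case by blast
qed

text \<open>
  This is the greedy bound for the square of the graph: at most \<open>m\<close> neighbors and at most
  \<open>m * m\<close> neighbors of neighbors compete with a vertex for its color.
\<close>
lemma distance_two_coloring:
  assumes G: "pair_graph G" and deg: "\<And>v. v \<in> pverts G \<Longrightarrow> card (neighbors G v) \<le> m"
  obtains c where "proper_coloring G (m + m * m + 1) c"
    and "\<And>x. inj_on c (neighbors G x)"
proof -
  interpret G: pair_graph G by fact
  define R where "R v w \<longleftrightarrow> w \<in> neighbors G v \<union> (\<Union>u\<in>neighbors G v. neighbors G u)" for v w
  have V: "neighbors G v \<subseteq> pverts G" for v
    by (auto simp: neighbors_def dest: G.wellformed')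
  then have fin: "finite (neighbors G v)" for v
    using G.pair_finite_verts finite_subset by blast
  have "symp R"
    by (rule sympI) (auto simp: R_def neighbors_def intro: G.arcs_symmetric)
  have bound: "card {w \<in> pverts G. w \<noteq> v \<and> R v w} \<le> m + m * m" if v: "v \<in> pverts G" for v
  proof -
    have "card (\<Union>u\<in>neighbors G v. neighbors G u) \<le> (\<Sum>u\<in>neighbors G v. card (neighbors G u))"
      by (rule card_UN_le[OF fin])
    also have "\<dots> \<le> card (neighbors G v) * m"
      using sum_bounded_above[of "neighbors G v" "\<lambda>u. card (neighbors G u)" m] deg V by auto
    also have "\<dots> \<le> m * m"
      using deg[OF v] by simp
    finally have two: "card (\<Union>u\<in>neighbors G v. neighbors G u) \<le> m * m" .
    have "card {w \<in> pverts G. w \<noteq> v \<and> R v w}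
        \<le> card (neighbors G v \<union> (\<Union>u\<in>neighbors G v. neighbors G u))"
      using fin by (intro card_mono) (auto simp: R_def)
    also have "\<dots> \<le> card (neighbors G v) + card (\<Union>u\<in>neighbors G v. neighbors G u)"
      by (rule card_Un_le)
    also have "\<dots> \<le> m + m * m"
      using deg[OF v] two by simp
    finally show ?thesis .
  qed
  obtain c :: "'a \<Rightarrow> nat" where c: "c ` pverts G \<subseteq> {..m + m * m}"
      "\<And>v w. v \<in> pverts G \<Longrightarrow> w \<in> pverts G \<Longrightarrow> w \<noteq> v \<Longrightarrow> R v w \<Longrightarrow> c v \<noteq> c w"
    using greedy_coloring[OF G.pair_finite_verts \<open>symp R\<close> bound] by blast
  show thesis
  proof
    have "c u \<noteq> c v" if "(u, v) \<in> parcs G" for u v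
      using c(2)[of u v] that G.wellformed'[OF that] G.no_loops'[OF that]
      by (auto simp: R_def neighbors_def)
    then show "proper_coloring G (m + m * m + 1) c"
      using c(1) by (auto simp: proper_coloring_def less_Suc_eq_le)
    show "inj_on c (neighbors G x)" for x
    proof (rule inj_onI, rule ccontr)
      fix u v assume uv: "u \<in> neighbors G x" "v \<in> neighbors G x" "c u = c v" "u \<noteq> v"
      then have "R u v"
        by (auto simp: R_def neighbors_def intro: G.arcs_symmetric)
      with c(2)[of u v] uv V show False by blast
    qed
  qed
qed

text \<open>
  The leaves of a copy of the avoided star have pairwise different colors, since they share the
  center as a neighbor, and none of them has the color of the center. So at least three colors
  occur.
\<close>
lemma distance_two_coloring_avoids_stars:
  assumes proper: "proper_coloring G k c" and inj: "\<And>x. inj_on c (neighbors G x)"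
    and M: "finite M" "y \<notin> M" "2 \<le> card M"
  shows "avoiding_coloring (star y M) G k c"
proof -
  have "\<not> card (c ` pverts S) \<le> 2" if S: "copy_of_in (star y M) S G" for S
  proof -
    obtain x L where L: "S = star x L" "L \<subseteq> neighbors G x" "card L = card M"
      using copy_of_starE[OF S M(1,2)] by blast
    have fin: "finite L"
      using L(3) M(3) by (intro card_ge_0_finite) simp
    have "c x \<notin> c ` L"
      using L(2) proper by (auto simp: neighbors_def proper_coloring_def)
    then have "card (c ` pverts S) = Suc (card (c ` L))"
      using L(1) fin by simp
    also have "card (c ` L) = card L"
      using inj_on_subset[OF inj L(2)] by (rule card_image)
    finally show ?thesis
      using L(3) M(3) by simp
  qed
  with proper show ?thesis
    by (auto simp: avoiding_coloring_def)
qed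

section \<open>Large stars\<close>

text \<open>
  If the center survives in the subgraph, it is the center of the star; otherwise no arc remains
  and any vertex is a star on its own.
\<close>
lemma nonempty_subgraph_of_star:
  assumes S: "pair_graph S" and ne: "pverts S \<noteq> {}"
    and sub: "subgraph (with_proj S) (with_proj (star x L))"
  obtains y N where "y \<notin> N" "insert y N \<subseteq> pverts S" "parcs S = parcs (star y N)"
proof -
  interpret S: pair_graph S by fact
  have arcs: "parcs S \<subseteq> {x} \<times> L \<union> L \<times> {x}"
    using sub by (auto simp: subgraph_def)
  show thesis
  proof (cases "x \<in> pverts S")
    case True
    show thesis
    proof
      show "x \<notin> neighbors S x"
        using S.no_loops' by (auto simp: neighbors_def)
      show "insert x (neighbors S x) \<subseteq> pverts S"
        using True by (auto simp: neighbors_def dest: S.wellformed')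
      show "parcs S = parcs (star x (neighbors S x))"
        using arcs by (auto simp: neighbors_def intro: S.arcs_symmetric)
    qed
  next
    case False
    then have "parcs S = {}"
      using arcs by (auto dest: S.wellformed')
    moreover obtain v where "v \<in> pverts S"
      using ne by blast
    ultimately show thesis
      using that[of v "{}"] by simp
  qed
qed

text \<open>
  The structure of a subgraph of a star is transported along the isomorphism to \<open>F\<close>, where it
  contradicts the two assumptions that exclude it.
\<close>
lemma star_is_free:
  assumes F: "pair_graph F" "pverts F \<noteq> {}" "\<not> is_star F" "\<not> star_with_isolated_vertices F"
    and L: "finite L" "x \<notin> L"
  shows "star x L \<in> free_class F"
proof -
  interpret F: pair_graph F by fact
  have False if copy: "copy_of_in F S (star x L)" for S
  proof -
    from copy have S: "pair_graph S" and sub: "subgraph (with_proj S) (with_proj (star x L))"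
      and iso: "digraph_iso (with_proj S) (with_proj F)"
      by (auto simp: copy_of_in_def)
    obtain f where f: "inj_on f (pverts S)" "pverts F = f ` pverts S"
        "parcs F = map_prod f f ` parcs S"
      using iso unfolding digraph_iso_pair_iff[OF S] by blast
    have "pverts S \<noteq> {}"
      using f(2) F(2) by auto
    then obtain y N where N: "y \<notin> N" "insert y N \<subseteq> pverts S" "parcs S = parcs (star y N)"
      using nonempty_subgraph_of_star[OF S _ sub] by blast
    have verts: "insert (f y) (f ` N) \<subseteq> pverts F"
      using N(2) f(2) by auto
    have arcs: "parcs F = {f y} \<times> f ` N \<union> f ` N \<times> {f y}"
      unfolding f(3) N(3) star_simps map_prod_star_arcs ..
    have "f y \<notin> f ` N"
      using f(1) N(1,2) by (auto simp: inj_on_def)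
    moreover have "finite (f ` N)"
      using verts by (intro finite_subset[OF _ F.pair_finite_verts]) simp
    ultimately have star: "is_star \<lparr>pverts = insert (f y) (f ` N), parcs = parcs F\<rparr>"
      unfolding is_star_iff star_def arcs by (intro exI[of _ "f y"] exI[of _ "f ` N"] conjI refl)
    show False
    proof (cases "insert (f y) (f ` N) = pverts F")
      case True
      moreover have "\<lparr>pverts = pverts F, parcs = parcs F\<rparr> = F"
        by simp
      ultimately show False
        using star F(3) by metis
    next
      case False
      with verts star F(4) show False
        unfolding star_with_isolated_vertices_def by blast
    qed
  qed
  then show ?thesis
    using pair_graph_star[OF L] by (auto simp: free_class_def)
qed

lemma large_color_class:
  fixes c :: "'a \<Rightarrow> nat"
  assumes "c ` A \<subseteq> {..<k}" and "k * d < card A"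
  obtains i where "d \<le> card {a \<in> A. c a = i}"
proof (rule ccontr)
  assume "\<not> thesis"
  then have small: "card {a \<in> A. c a = i} \<le> d" for i
    using that[of i] by linarith
  have "A = (\<Union>i<k. {a \<in> A. c a = i})"
    using assms(1) by auto
  then have "card A \<le> (\<Sum>i<k. card {a \<in> A. c a = i})"
    by (metis card_UN_le finite_lessThan)
  also have "\<dots> \<le> k * d"
    using sum_bounded_above[of "{..<k}" "\<lambda>i. card {a \<in> A. c a = i}" d] small by simp
  finally show False
    using assms(2) by simp
qed

lemma large_star_has_no_avoiding_coloring:
  assumes L: "finite L" "x \<notin> L" "k * card M < card L" and M: "finite M" "y \<notin> M"
  shows "\<not> avoiding_coloring (star y M) (star x L) k c"
proof
  assume avoiding: "avoiding_coloring (star y M) (star x L) k c"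
  then have "c ` L \<subseteq> {..<k}"
    by (auto simp: avoiding_coloring_def proper_coloring_def)
  then obtain i where "card M \<le> card {a \<in> L. c a = i}"
    using large_color_class L(3) by blast
  then obtain N where N: "N \<subseteq> {a \<in> L. c a = i}" "card N = card M"
    by (metis obtain_subset_with_card_n)
  have "copy_of_in (star y M) (star x N) (star x L)"
    using N M by (intro copy_of_starI pair_graph_star L) (auto simp: neighbors_def)
  moreover have "card (c ` pverts (star x N)) \<le> 2"
  proof -
    have "c ` pverts (star x N) \<subseteq> {c x, i}"
      using N(1) by auto
    then have "card (c ` pverts (star x N)) \<le> card {c x, i}"
      by (rule card_mono[rotated]) simp
    also have "\<dots> \<le> 2"
      by (simp add: card_insert_if)
    finally show ?thesis .
  qed
  ultimately show False
    using avoiding by (auto simp: avoiding_coloring_def)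
qed

section \<open>Characterization of bounded star-avoiding chromatic number\<close>

theorem theorem1p3:
  fixes H :: "'a pair_pre_digraph" and F :: "'b pair_pre_digraph"
  assumes "is_star H" and "3 \<le> card (pverts H)"
    and "pair_graph F" and "pverts F \<noteq> {}" and "\<not> star_with_isolated_vertices F"
  shows "bounded_avoiding_chromatic_number H (free_class F) \<longleftrightarrow> is_star F"
proof -
  obtain y M where M: "finite M" "y \<notin> M" and H: "H = star y M"
    using assms(1) unfolding is_star_iff by blast
  have M2: "2 \<le> card M"
    using assms(2) M H by simp
  show ?thesis
  proof
    assume "bounded_avoiding_chromatic_number H (free_class F)"
    then obtain k where k: "\<And>G. G \<in> free_class F \<Longrightarrow> \<exists>c. avoiding_coloring H G k c"
      unfolding bounded_avoiding_chromatic_number_def by blast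
    show "is_star F"
    proof (rule ccontr)
      assume "\<not> is_star F"
      let ?L = "{1..k * card M + 1}"
      have "star 0 ?L \<in> free_class F"
        by (rule star_is_free) (use assms \<open>\<not> is_star F\<close> in auto)
      then obtain c where "avoiding_coloring H (star 0 ?L) k c"
        using k by blast
      then show False
        using large_star_has_no_avoiding_coloring[of ?L 0 k M y c] M H by simp
    qed
  next
    assume "is_star F"
    then obtain z N where N: "finite N" "z \<notin> N" and F: "F = star z N"
      unfolding is_star_iff by blast
    let ?m = "card N"
    have "\<exists>c. avoiding_coloring H G (?m + ?m * ?m + 1) c" if G: "G \<in> free_class F" for G
    proof -
      have "pair_graph G"
        using G by (simp add: free_class_def)
      moreover have "card (neighbors G v) \<le> ?m" if "v \<in> pverts G" for v
        using star_free_degree[OF _ N that] G F by (simp add: less_imp_le)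
      ultimately obtain c where "proper_coloring G (?m + ?m * ?m + 1) c"
          "\<And>x. inj_on c (neighbors G x)"
        using distance_two_coloring by blast
      then have "avoiding_coloring H G (?m + ?m * ?m + 1) c"
        unfolding H using M M2 by (rule distance_two_coloring_avoids_stars)
      then show ?thesis by blast
    qed
    then show "bounded_avoiding_chromatic_number H (free_class F)"
      unfolding bounded_avoiding_chromatic_number_def by blast
  qed
qed

end
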